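(* Every edge-symmetric $n$-person terminal game $\Gamma=(G,v_0,\mathcal{L})$ has a Nash equilibrium (in pure stationary strategies).
   Context: **Terminal games.** $G=(V,E)$ is a finite directed graph (loops allowed); vertices are positions, directed edges are moves. $I=\{1,\dots,n\}$ is the set of players. $V=V_1\cup\dots\cup V_n\cup V_T$ is a given partition of $V$, where $V_i$ is the set of positions controlled by player $i$ and $V_T\ne\emptyset$ is the set of terminal positions; terminals are exactly the positions with no outgoing edge. $v_0\in V\setminus V_T$ is the initial position. $\mathcal{L}=(\mathcal{L}^i\mid i\in I)$ with $\mathcal{L}^i:V_T\to\mathbb{R}$ arbitrary functions (values may be positive, zero or negative). A (pure stationary) strategy of player $i$ is a map $\sigma_i:V_i\to V$ with $(v,\sigma_i(v))\in E$ for all $v\in V_i$. A situation is a tuple $\sigma=(\sigma_i\mid i\in I)$ of strategies. The play $P(\sigma)$ is the directed walk starting at $v_0$ that from each position $v\in V_i$ moves to $\sigma_i(v)$; it either reaches a terminal and stops, or is infinite. The effective cost $\mathcal{L}^i(\sigma)$ of player $i$ is $\mathcal{L}^i(w)$ if $P(\sigma)$ terminates at $w\in V_T$, and $0$ if $P(\sigma)$ is infinite. All players minimize their effective cost. A situation $\sigma$ is a Nash equilibrium if $\mathcal{L}^i(\sigma)\le\mathcal{L}^i(\sigma')$ for every player $i$ and every situation $\sigma'$ that may differ from $\sigma$ only in the strategy of player $i$. The game is edge-symmetric if $G$ is symmetric: $(u,v)\in E$ whenever $(v,u)\in E$, except if $u\in V_T$. *)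

theory Defs
  imports Complex_Main "HOL-Library.FuncSet" "HOL-Library.Disjoint_Sets"
    "Graph_Theory.Pair_Digraph"
begin

record 'v game_data =
  graph :: "'v pair_pre_digraph"
  num_players :: nat
  control :: "nat \<Rightarrow> 'v set"
  terminals :: "'v set"
  initial :: 'v
  cost :: "nat \<Rightarrow> 'v \<Rightarrow> real"

definition players :: "'v game_data \<Rightarrow> nat set" where
  "players \<Gamma> = {1..num_players \<Gamma>}"

text \<open>Players controlling no position are allowed. The values of \<open>control\<close> outside the player
  set, and those of \<open>cost\<close> outside players and terminals, are irrelevant.\<close>

definition terminal_game :: "'v game_data \<Rightarrow> bool" where
  "terminal_game \<Gamma> \<longleftrightarrow>
     pair_fin_digraph (graph \<Gamma>) \<and>
     pverts (graph \<Gamma>) = (\<Union>i\<in>players \<Gamma>. control \<Gamma> i) \<union> terminals \<Gamma> \<and>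
     disjoint_family_on (control \<Gamma>) (players \<Gamma>) \<and>
     (\<forall>i\<in>players \<Gamma>. control \<Gamma> i \<inter> terminals \<Gamma> = {}) \<and>
     terminals \<Gamma> \<noteq> {} \<and>
     (\<forall>v\<in>pverts (graph \<Gamma>). v \<in> terminals \<Gamma> \<longleftrightarrow> (\<nexists>u. (v, u) \<in> parcs (graph \<Gamma>))) \<and>
     initial \<Gamma> \<in> pverts (graph \<Gamma>) - terminals \<Gamma>"

definition edge_symmetric :: "'v game_data \<Rightarrow> bool" where
  "edge_symmetric \<Gamma> \<longleftrightarrow>
     (\<forall>u v. (v, u) \<in> parcs (graph \<Gamma>) \<longrightarrow> u \<notin> terminals \<Gamma> \<longrightarrow> (u, v) \<in> parcs (graph \<Gamma>))"

definition strategies :: "'v game_data \<Rightarrow> nat \<Rightarrow> ('v \<Rightarrow> 'v) set" where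
  "strategies \<Gamma> i = (\<Pi>\<^sub>E v\<in>control \<Gamma> i. {u. (v, u) \<in> parcs (graph \<Gamma>)})"

definition situations :: "'v game_data \<Rightarrow> (nat \<Rightarrow> 'v \<Rightarrow> 'v) set" where
  "situations \<Gamma> = (\<Pi>\<^sub>E i\<in>players \<Gamma>. strategies \<Gamma> i)"

text \<open>The controlling player is unique for every non-terminal position of a terminal game.\<close>

definition controller :: "'v game_data \<Rightarrow> 'v \<Rightarrow> nat" where
  "controller \<Gamma> v = (THE i. i \<in> players \<Gamma> \<and> v \<in> control \<Gamma> i)"

text \<open>\<open>play \<Gamma> \<sigma> k\<close> is the position after \<open>k\<close> moves; a play that has stopped at a terminal is
  continued by repeating that terminal, so that plays are total sequences.\<close>

primrec play :: "'v game_data \<Rightarrow> (nat \<Rightarrow> 'v \<Rightarrow> 'v) \<Rightarrow> nat \<Rightarrow> 'v" where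
  "play \<Gamma> \<sigma> 0 = initial \<Gamma>"
| "play \<Gamma> \<sigma> (Suc k) =
     (let v = play \<Gamma> \<sigma> k in if v \<in> terminals \<Gamma> then v else \<sigma> (controller \<Gamma> v) v)"

definition play_terminates :: "'v game_data \<Rightarrow> (nat \<Rightarrow> 'v \<Rightarrow> 'v) \<Rightarrow> bool" where
  "play_terminates \<Gamma> \<sigma> \<longleftrightarrow> (\<exists>k. play \<Gamma> \<sigma> k \<in> terminals \<Gamma>)"

definition final_position :: "'v game_data \<Rightarrow> (nat \<Rightarrow> 'v \<Rightarrow> 'v) \<Rightarrow> 'v" where
  "final_position \<Gamma> \<sigma> = play \<Gamma> \<sigma> (LEAST k. play \<Gamma> \<sigma> k \<in> terminals \<Gamma>)"

definition effective_cost :: "'v game_data \<Rightarrow> nat \<Rightarrow> (nat \<Rightarrow> 'v \<Rightarrow> 'v) \<Rightarrow> real" where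
  "effective_cost \<Gamma> i \<sigma> =
     (if play_terminates \<Gamma> \<sigma> then cost \<Gamma> i (final_position \<Gamma> \<sigma>) else 0)"

definition nash_equilibrium :: "'v game_data \<Rightarrow> (nat \<Rightarrow> 'v \<Rightarrow> 'v) \<Rightarrow> bool" where
  "nash_equilibrium \<Gamma> \<sigma> \<longleftrightarrow>
     \<sigma> \<in> situations \<Gamma> \<and>
     (\<forall>i\<in>players \<Gamma>. \<forall>\<sigma>'\<in>situations \<Gamma>.
        (\<forall>j\<in>players \<Gamma> - {i}. \<sigma>' j = \<sigma> j) \<longrightarrow>
        effective_cost \<Gamma> i \<sigma> \<le> effective_cost \<Gamma> i \<sigma>')"

end

theory Submission
  imports Defs
begin

text \<open>Call the connected component of a position within the positions of the same owner its block.
  By symmetry, all neighbours of a block can move back into it, which leaves its owner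
  only the terminals adjacent to the block (its exits) and infinite play.

  Let \<open>i\<close> own the initial position \<open>v\<close> and let its block \<open>B\<close> be protected in this way. If \<open>B\<close> has
  an exit of cost at most \<open>0\<close>, then \<open>i\<close> takes a best one. Otherwise, if \<open>B\<close> contains an edge,
  then \<open>i\<close> cycles in \<open>B\<close>. Otherwise \<open>B = {v}\<close>. If the block of some neighbour \<open>u\<close> of \<open>v\<close> has no exit of
  negative cost for its owner, then the play stays in \<open>v\<close> and the block of \<open>u\<close> forever, and their
  neighbours move back. Otherwise every neighbouring block plans to leave through a best exit, and
  \<open>i\<close> moves to the neighbour, terminal or not, with the outcome \<open>i\<close> likes best. If this
  neighbour lies in a block \<open>U\<close>, then the neighbours of \<open>U\<close> are redirected into \<open>U\<close>:
  this stops the owner of \<open>U\<close> and gives \<open>i\<close> no new outcome.\<close>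

locale edge_symmetric_game =
  fixes \<Gamma> :: "'v game_data"
  assumes terminal_game: "terminal_game \<Gamma>"
    and edge_symmetric: "edge_symmetric \<Gamma>"
begin

section \<open>Arcs, terminals and owners of positions\<close>

abbreviation E where "E \<equiv> parcs (graph \<Gamma>)"
abbreviation T where "T \<equiv> terminals \<Gamma>"
abbreviation start where "start \<equiv> initial \<Gamma>"
abbreviation owner where "owner \<equiv> controller \<Gamma>"

lemma arcs_in_verts: "E \<subseteq> pverts (graph \<Gamma>) \<times> pverts (graph \<Gamma>)"
proof -
  interpret pair_fin_digraph "graph \<Gamma>"
    using terminal_game by (simp add: terminal_game_def)
  show ?thesis using in_arcsD1 in_arcsD2 by auto
qed

lemma finite_arcs: "finite E"
proof -
  interpret pair_fin_digraph "graph \<Gamma>"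
    using terminal_game by (simp add: terminal_game_def)
  show ?thesis by (rule pair_finite_arcs)
qed

lemma nonterminal_iff: "v \<in> Domain E \<longleftrightarrow> v \<in> pverts (graph \<Gamma>) - T"
  using terminal_game arcs_in_verts unfolding terminal_game_def by blast

lemma start_nonterminal: "start \<in> Domain E"
  using terminal_game nonterminal_iff unfolding terminal_game_def by blast

lemma tail_nonterminal: "(v, w) \<in> E \<Longrightarrow> v \<notin> T"
  using nonterminal_iff by blast

lemma arc_sym: "(v, w) \<in> E \<Longrightarrow> w \<notin> T \<Longrightarrow> (w, v) \<in> E"
  using edge_symmetric unfolding edge_symmetric_def by blast

lemma controller_eq: "i \<in> players \<Gamma> \<Longrightarrow> v \<in> control \<Gamma> i \<Longrightarrow> owner v = i"
  unfolding controller_def using terminal_game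
  by (intro the_equality) (auto simp: terminal_game_def disjoint_family_on_def)

lemma controller_spec:
  assumes "v \<in> Domain E"
  shows "owner v \<in> players \<Gamma>" "v \<in> control \<Gamma> (owner v)"
proof -
  have "v \<in> (\<Union>i\<in>players \<Gamma>. control \<Gamma> i)"
    using assms terminal_game nonterminal_iff unfolding terminal_game_def by blast
  then obtain i where "i \<in> players \<Gamma>" "v \<in> control \<Gamma> i" by blast
  then show "owner v \<in> players \<Gamma>" "v \<in> control \<Gamma> (owner v)"
    by (simp_all add: controller_eq)
qed

lemma control_nonterminal: "i \<in> players \<Gamma> \<Longrightarrow> v \<in> control \<Gamma> i \<Longrightarrow> v \<in> Domain E"
  using terminal_game unfolding nonterminal_iff terminal_game_def by blast

subsection \<open>Outcomes of plays\<close>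

lemma situation_arc:
  assumes "\<sigma> \<in> situations \<Gamma>" "v \<in> Domain E"
  shows "(v, \<sigma> (owner v) v) \<in> E"
proof -
  have "\<sigma> (owner v) \<in> strategies \<Gamma> (owner v)"
    using assms controller_spec(1) by (auto simp: situations_def PiE_iff)
  then show ?thesis
    using assms controller_spec(2) by (auto simp: strategies_def PiE_iff)
qed

text \<open>\<open>R\<close> is either the graph of a successor function, for the intended play, or
  \<open>moves p f\<close>, for deviations. The second conjunct is carried along since
  \<open>follow\<close> speaks only of positions with an arc; it survives because every arc into a
  non-terminal can be reversed.\<close>

lemma play_invariant:
  assumes "\<sigma> \<in> situations \<Gamma>" "start \<in> S"
    and follow: "\<And>v. v \<in> Domain E \<Longrightarrow> (v, \<sigma> (owner v) v) \<in> R"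
    and "R `` S \<subseteq> S"
  shows "play \<Gamma> \<sigma> k \<in> S \<and> play \<Gamma> \<sigma> k \<in> T \<union> Domain E"
proof (induction k)
  case 0
  then show ?case using assms start_nonterminal by simp
next
  case (Suc k)
  show ?case
  proof (cases "play \<Gamma> \<sigma> k \<in> T")
    case True
    then show ?thesis using Suc by (simp add: Let_def)
  next
    case False
    let ?v = "play \<Gamma> \<sigma> k"
    have v: "?v \<in> Domain E" "?v \<in> S" using Suc False by auto
    have "(?v, \<sigma> (owner ?v) ?v) \<in> E" using situation_arc[OF assms(1) v(1)] .
    then have "\<sigma> (owner ?v) ?v \<in> T \<union> Domain E" using arc_sym by blast
    moreover have "\<sigma> (owner ?v) ?v \<in> S" using follow[OF v(1)] v(2) assms(4) by blast
    ultimately show ?thesis using False by (simp add: Let_def)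
  qed
qed

lemma final_position_in:
  assumes "\<And>k. play \<Gamma> \<sigma> k \<in> S" "play_terminates \<Gamma> \<sigma>"
  shows "final_position \<Gamma> \<sigma> \<in> S \<inter> T"
  using assms unfolding play_terminates_def final_position_def by (auto intro: LeastI)

text \<open>Each move uses up at least one unit of rank, and only \<open>r start\<close> units are
  available.\<close>

lemma play_terminates_if_rank:
  fixes r :: "'v \<Rightarrow> nat"
  assumes "\<sigma> \<in> situations \<Gamma>" "start \<in> S"
    and follow: "\<And>v. v \<in> Domain E \<Longrightarrow> (v, \<sigma> (owner v) v) \<in> R"
    and "R `` S \<subseteq> S"
    and rank: "\<And>v w. v \<in> S \<Longrightarrow> (v, w) \<in> R \<Longrightarrow> r w < r v"
  shows "play_terminates \<Gamma> \<sigma>"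
proof (rule ccontr)
  assume "\<not> play_terminates \<Gamma> \<sigma>"
  then have nt: "play \<Gamma> \<sigma> k \<notin> T" for k by (simp add: play_terminates_def)
  have "r (play \<Gamma> \<sigma> k) + k \<le> r start" for k
  proof (induction k)
    case (Suc k)
    let ?v = "play \<Gamma> \<sigma> k"
    have "?v \<in> S" "?v \<in> Domain E" using play_invariant[OF assms(1-4), of k] nt by auto
    then have "r (\<sigma> (owner ?v) ?v) < r ?v" using follow rank by blast
    then show ?case using Suc nt by (simp add: Let_def)
  qed simp
  from this[of "Suc (r start)"] show False by simp
qed

section \<open>Guards against unilateral deviations\<close>

definition moves :: "nat \<Rightarrow> ('v \<Rightarrow> 'v) \<Rightarrow> ('v \<times> 'v) set" where
  "moves p f = {(v, w) \<in> E. owner v = p \<or> w = f v}"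

text \<open>A guard confines every deviation of \<open>p\<close> from \<open>f\<close> to a set of positions whose terminals
  cost \<open>p\<close> at least \<open>x\<close>. The rank excludes infinite plays, which only matters when \<open>x\<close>
  exceeds their cost \<open>0\<close>.\<close>

definition guard :: "nat \<Rightarrow> ('v \<Rightarrow> 'v) \<Rightarrow> real \<Rightarrow> 'v set \<Rightarrow> bool" where
  "guard p f x S \<longleftrightarrow> start \<in> S \<and> moves p f `` S \<subseteq> S \<and> (\<forall>t\<in>S \<inter> T. x \<le> cost \<Gamma> p t) \<and>
     (x \<le> 0 \<or> (\<exists>r :: 'v \<Rightarrow> nat. \<forall>v w. v \<in> S \<longrightarrow> (v, w) \<in> moves p f \<longrightarrow> r w < r v))"

lemma guard_cost:
  assumes "\<sigma> \<in> situations \<Gamma>" "guard p f x S"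
    and follow: "\<And>v. v \<in> Domain E \<Longrightarrow> (v, \<sigma> (owner v) v) \<in> moves p f"
  shows "x \<le> effective_cost \<Gamma> p \<sigma>"
proof (cases "play_terminates \<Gamma> \<sigma>")
  case True
  have "play \<Gamma> \<sigma> k \<in> S" for k
    using play_invariant[OF assms(1) _ follow] assms(2) by (auto simp: guard_def)
  then show ?thesis
    using final_position_in[OF _ True, of S] True assms(2)
    by (auto simp: guard_def effective_cost_def)
next
  case False
  have "x \<le> 0"
  proof (rule ccontr)
    assume "\<not> x \<le> 0"
    then obtain r :: "'v \<Rightarrow> nat" where "\<And>v w. v \<in> S \<Longrightarrow> (v, w) \<in> moves p f \<Longrightarrow> r w < r v"
      using assms(2) unfolding guard_def by blast
    then show False
      using play_terminates_if_rank[OF assms(1) _ follow, of S r] assms(2) False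
      by (auto simp: guard_def)
  qed
  then show ?thesis using False by (simp add: effective_cost_def)
qed

section \<open>Situations given by one successor function, and criteria for equilibrium\<close>

definition situation_of :: "('v \<Rightarrow> 'v) \<Rightarrow> nat \<Rightarrow> 'v \<Rightarrow> 'v" where
  "situation_of f = (\<lambda>i\<in>players \<Gamma>. \<lambda>v\<in>control \<Gamma> i. f v)"

lemma situation_of_in:
  assumes "\<And>v. v \<in> Domain E \<Longrightarrow> (v, f v) \<in> E"
  shows "situation_of f \<in> situations \<Gamma>"
  using assms control_nonterminal
  by (auto simp: situation_of_def situations_def strategies_def PiE_iff)

lemma situation_of_apply: "v \<in> Domain E \<Longrightarrow> situation_of f (owner v) v = f v"
  using controller_spec by (simp add: situation_of_def)

lemma situation_of_moves:
  assumes "\<And>v. v \<in> Domain E \<Longrightarrow> (v, f v) \<in> E" "v \<in> Domain E"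
  shows "(v, situation_of f (owner v) v) \<in> moves p f"
  using assms by (simp add: situation_of_apply moves_def)

text \<open>\<open>moves\<close> leaves every position of \<open>p\<close> free, so a set closed
  under it handles all strategies of \<open>p\<close> at once.\<close>

lemma deviation_moves:
  assumes "\<sigma> \<in> situations \<Gamma>" "\<forall>j\<in>players \<Gamma> - {p}. \<sigma> j = situation_of f j" "v \<in> Domain E"
  shows "(v, \<sigma> (owner v) v) \<in> moves p f"
proof (cases "owner v = p")
  case False
  then have "\<sigma> (owner v) v = f v"
    using assms(2) controller_spec(1)[OF assms(3)] situation_of_apply[OF assms(3)] by simp
  then show ?thesis using situation_arc[OF assms(1,3)] by (simp add: moves_def)
qed (use situation_arc[OF assms(1,3)] in \<open>simp add: moves_def\<close>)

lemma nash_if_guards: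
  assumes f: "\<And>v. v \<in> Domain E \<Longrightarrow> (v, f v) \<in> E"
    and cost: "\<And>p. effective_cost \<Gamma> p (situation_of f) = x p"
    and guards: "\<And>p. \<exists>S. guard p f (x p) S"
  shows "\<exists>\<sigma>. nash_equilibrium \<Gamma> \<sigma>"
proof
  show "nash_equilibrium \<Gamma> (situation_of f)"
    unfolding nash_equilibrium_def
  proof (intro conjI ballI impI)
    show "situation_of f \<in> situations \<Gamma>" using situation_of_in f .
    fix p \<sigma> assume "\<sigma> \<in> situations \<Gamma>" "\<forall>j\<in>players \<Gamma> - {p}. \<sigma> j = situation_of f j"
    moreover obtain S where "guard p f (x p) S" using guards by blast
    ultimately show "effective_cost \<Gamma> p (situation_of f) \<le> effective_cost \<Gamma> p \<sigma>"
      unfolding cost using guard_cost deviation_moves by blast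
  qed
qed

text \<open>A player owning nothing in \<open>Q\<close> cannot influence a play that
  \<open>f\<close> keeps in \<open>Q\<close>, so \<open>Q\<close> itself is the guard; only owners
  in \<open>Q\<close> need one of their own.\<close>

lemma nash_infinite:
  assumes f: "\<And>v. v \<in> Domain E \<Longrightarrow> (v, f v) \<in> E"
    and Q: "start \<in> Q" "\<And>v. v \<in> Q \<Longrightarrow> f v \<in> Q" "Q \<inter> T = {}"
    and guards: "\<And>p. p \<in> owner ` Q \<Longrightarrow> \<exists>S. guard p f 0 S"
  shows "\<exists>\<sigma>. nash_equilibrium \<Gamma> \<sigma>"
proof (rule nash_if_guards[OF f])
  have "play \<Gamma> (situation_of f) k \<in> Q" for k
    using play_invariant[OF situation_of_in[OF f] Q(1), of "{(v, f v) |v. True}"] Q(2)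
    by (auto simp: situation_of_apply)
  then have "\<not> play_terminates \<Gamma> (situation_of f)"
    using Q(3) by (auto simp: play_terminates_def)
  then show "effective_cost \<Gamma> p (situation_of f) = (\<lambda>_. 0) p" for p
    by (simp add: effective_cost_def)
  show "\<exists>S. guard p f ((\<lambda>_. 0) p) S" for p
  proof (cases "p \<in> owner ` Q")
    case False
    then have "guard p f 0 Q" using Q by (auto simp: guard_def moves_def)
    then show ?thesis by auto
  qed (use guards in auto)
qed

text \<open>The rank does double duty: it forces the intended play to end, necessarily at
  \<open>t\<close>, and it makes \<open>Q\<close> a guard against the uninvolved players even if
  \<open>t\<close> costs them more than 0.\<close>

lemma nash_finite:
  fixes r :: "'v \<Rightarrow> nat"
  assumes f: "\<And>v. v \<in> Domain E \<Longrightarrow> (v, f v) \<in> E"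
    and Q: "start \<in> Q" "\<And>v. v \<in> Q \<Longrightarrow> v \<notin> T \<Longrightarrow> f v \<in> Q \<and> r (f v) < r v" "Q \<inter> T \<subseteq> {t}"
    and guards: "\<And>p. p \<in> owner ` (Q - T) \<Longrightarrow> \<exists>S. guard p f (cost \<Gamma> p t) S"
  shows "\<exists>\<sigma>. nash_equilibrium \<Gamma> \<sigma>"
proof (rule nash_if_guards[OF f])
  let ?R = "{(v, f v) |v. v \<notin> T}"
  note follow = play_invariant[OF situation_of_in[OF f] Q(1), of ?R]
    play_terminates_if_rank[OF situation_of_in[OF f] Q(1), of ?R r]
  have nT: "v \<in> Domain E \<Longrightarrow> v \<notin> T" for v using tail_nonterminal by blast
  have "play \<Gamma> (situation_of f) k \<in> Q" for k
    using follow(1) Q(2) nT by (auto simp: situation_of_apply)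
  moreover have terminates: "play_terminates \<Gamma> (situation_of f)"
    using follow(2) Q(2) nT by (auto simp: situation_of_apply)
  ultimately have "final_position \<Gamma> (situation_of f) = t"
    using final_position_in Q(3) by blast
  then show "effective_cost \<Gamma> p (situation_of f) = (\<lambda>p. cost \<Gamma> p t) p" for p
    using terminates by (simp add: effective_cost_def)
  show "\<exists>S. guard p f ((\<lambda>p. cost \<Gamma> p t) p) S" for p
  proof (cases "p \<in> owner ` (Q - T)")
    case False
    have step: "w \<in> Q \<and> r w < r v" if "v \<in> Q" "(v, w) \<in> moves p f" for v w
    proof -
      have "v \<notin> T" using that tail_nonterminal by (auto simp: moves_def)
      then have "w = f v" using that False by (auto simp: moves_def)
      then show ?thesis using Q(2) that(1) \<open>v \<notin> T\<close> by blast
    qed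
    have "guard p f (cost \<Gamma> p t) Q"
      unfolding guard_def using Q(1,3) step by blast
    then show ?thesis by auto
  qed (use guards in auto)
qed

subsection \<open>Blocks\<close>

definition link :: "('v \<times> 'v) set" where
  "link = {(v, w) \<in> E. w \<notin> T \<and> owner w = owner v}"

definition block :: "'v \<Rightarrow> 'v set" where
  "block v = link\<^sup>* `` {v}"

lemma sym_link: "sym link"
proof (rule symI)
  fix v w assume "(v, w) \<in> link"
  then have "(v, w) \<in> E" "w \<notin> T" "owner w = owner v" by (simp_all add: link_def)
  then show "(w, v) \<in> link" using arc_sym[of v w] tail_nonterminal[of v w] by (simp add: link_def)
qed

lemma block_self: "v \<in> block v"
  by (simp add: block_def)

lemma block_eq: "w \<in> block v \<Longrightarrow> block w = block v"
  using symD[OF sym_rtrancl[OF sym_link], of v w] unfolding block_def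
  by (auto intro: rtrancl_trans)

lemma block_link: "w \<in> block v \<Longrightarrow> (w, u) \<in> link \<Longrightarrow> u \<in> block v"
  unfolding block_def by (auto intro: rtrancl_into_rtrancl)

lemma block_arc:
  "w \<in> block v \<Longrightarrow> (w, u) \<in> E \<Longrightarrow> u \<notin> T \<Longrightarrow> owner u = owner v \<Longrightarrow> owner w = owner v \<Longrightarrow> u \<in> block v"
  by (rule block_link) (auto simp: link_def)

lemma block_props:
  assumes "w \<in> block v" "v \<in> Domain E"
  shows "owner w = owner v" "w \<in> Domain E" "w \<notin> T"
proof -
  have "(v, w) \<in> link\<^sup>*" using assms by (simp add: block_def)
  then have "owner w = owner v \<and> w \<in> Domain E"
    by (induction rule: rtrancl_induct) (use assms arc_sym in \<open>auto simp: link_def\<close>)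
  then show "owner w = owner v" "w \<in> Domain E" "w \<notin> T" using tail_nonterminal by blast+
qed

text \<open>The last link of a path from \<open>v\<close> to \<open>w\<close> can be reversed, so
  only \<open>v\<close> can lack a neighbour in its block. This is the source of cycles.\<close>

lemma block_neighbour:
  assumes "w \<in> block v" "w \<noteq> v"
  shows "\<exists>u\<in>block v. (w, u) \<in> E"
proof -
  have "(v, w) \<in> link\<^sup>*" using assms(1) by (simp add: block_def)
  then obtain u where "(v, u) \<in> link\<^sup>*" "(u, w) \<in> link" using assms(2) by (cases rule: rtranclE) auto
  moreover from this have "(w, u) \<in> link" using symD[OF sym_link] by blast
  ultimately show ?thesis by (auto simp: block_def link_def)
qed

definition exits :: "'v \<Rightarrow> 'v set" where
  "exits v = E `` block v \<inter> T"

definition best :: "'v \<Rightarrow> 'v" where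
  "best v = arg_min_on (cost \<Gamma> (owner v)) (exits v)"

lemma finite_exits: "finite (exits v)"
  using finite_arcs by (auto simp: exits_def intro: finite_subset[of _ "Range E"] finite_Range)

lemma best_exits: "exits v \<noteq> {} \<Longrightarrow> best v \<in> exits v"
  unfolding best_def by (rule arg_min_if_finite(1)[OF finite_exits])

lemma best_le: "t \<in> exits v \<Longrightarrow> cost \<Gamma> (owner v) (best v) \<le> cost \<Gamma> (owner v) t"
  unfolding best_def by (rule arg_min_least[OF finite_exits]) auto

lemma exits_block: "w \<in> block v \<Longrightarrow> exits w = exits v"
  by (simp add: exits_def block_eq)

text \<open>Ties are broken by owner and exit set only, both constant on a block, so the whole block
  aims at one terminal.\<close>

lemma best_block: "w \<in> block v \<Longrightarrow> v \<in> Domain E \<Longrightarrow> best w = best v"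
  by (simp add: best_def exits_block block_props)

text \<open>Sends neighbours of \<open>B\<close> into \<open>B\<close>. The fallback to an arbitrary
  arc elsewhere keeps the resulting strategies admissible.\<close>

definition pick :: "'v set \<Rightarrow> 'v \<Rightarrow> 'v" where
  "pick B v = (SOME w. (v, w) \<in> E \<and> (E `` {v} \<inter> B \<noteq> {} \<longrightarrow> w \<in> B))"

lemma pick:
  assumes "v \<in> Domain E"
  shows "(v, pick B v) \<in> E" "(v, w) \<in> E \<Longrightarrow> w \<in> B \<Longrightarrow> pick B v \<in> B"
proof -
  have "\<exists>w. (v, w) \<in> E \<and> (E `` {v} \<inter> B \<noteq> {} \<longrightarrow> w \<in> B)" using assms by blast
  from someI_ex[OF this]
  show "(v, pick B v) \<in> E" "(v, w) \<in> E \<Longrightarrow> w \<in> B \<Longrightarrow> pick B v \<in> B"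
    unfolding pick_def by blast+
qed

lemmas pick_arc = pick(1)

lemma pick_in: "(v, w) \<in> E \<Longrightarrow> w \<in> B \<Longrightarrow> pick B v \<in> B"
  using pick(2) by blast

text \<open>\<open>d\<close> is the distance within the block to a position next to the best exit,
  and \<open>g\<close> follows shortest paths.\<close>

lemma route:
  obtains g and d :: "'v \<Rightarrow> nat" where
    "\<And>v. v \<in> Domain E \<Longrightarrow> (v, g v) \<in> E"
    "\<And>v. v \<in> Domain E \<Longrightarrow> exits v \<noteq> {} \<Longrightarrow> g v = best v \<or> g v \<in> block v \<and> d (g v) < d v"
proof -
  \<comment> \<open>Writing \<open>best e\<close> instead of \<open>best v\<close> changes nothing
    within a block, and lets the property pass unchanged to later positions of the path.\<close>
  define near where "near v k \<longleftrightarrow> (\<exists>e. (v, e) \<in> link ^^ k \<and> (e, best e) \<in> E)" for v k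
  define d where "d v = (LEAST k. near v k)" for v
  have "\<exists>w. (v, w) \<in> E \<and> (exits v \<noteq> {} \<longrightarrow> w = best v \<or> w \<in> block v \<and> d w < d v)"
    if v: "v \<in> Domain E" for v
  proof (cases "exits v = {}")
    case True
    then show ?thesis using v by blast
  next
    case False
    then obtain e where e: "e \<in> block v" "(e, best v) \<in> E"
      using best_exits by (auto simp: exits_def)
    then have "(v, e) \<in> link\<^sup>*" "best e = best v" using best_block v by (auto simp: block_def)
    then have "\<exists>k. near v k" using e(2) by (metis near_def rtrancl_imp_relpow)
    then have least: "near v (d v)" unfolding d_def by (auto intro: LeastI)
    then obtain e' where e': "(v, e') \<in> link ^^ d v" "(e', best e') \<in> E" by (auto simp: near_def)
    show ?thesis
    proof (cases "d v")
      case 0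
      then show ?thesis using e' by auto
    next
      case (Suc k)
      \<comment> \<open>The rest of a shortest path bounds the distance from its second
        position.\<close>
      then obtain w where w: "(v, w) \<in> link" "(w, e') \<in> link ^^ k"
        using e'(1) by (metis relpow_Suc_E2)
      then have "d w \<le> k" unfolding d_def using e'(2) by (intro Least_le) (auto simp: near_def)
      then show ?thesis using w(1) Suc block_link[OF block_self] by (auto simp: link_def)
    qed
  qed
  then have "\<forall>v\<in>Domain E. \<exists>w. (v, w) \<in> E \<and>
      (exits v \<noteq> {} \<longrightarrow> w = best v \<or> w \<in> block v \<and> d w < d v)" by (rule ballI)
  from bchoice[OF this] obtain g where g: "\<forall>v\<in>Domain E. (v, g v) \<in> E \<and>
      (exits v \<noteq> {} \<longrightarrow> g v = best v \<or> g v \<in> block v \<and> d (g v) < d v)" by (elim exE)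
  show ?thesis
  proof (rule that[of g d])
    fix v assume v: "v \<in> Domain E"
    show "(v, g v) \<in> E" using bspec[OF g v] by (rule conjunct1)
    assume "exits v \<noteq> {}"
    then show "g v = best v \<or> g v \<in> block v \<and> d (g v) < d v"
      by (rule mp[OF conjunct2[OF bspec[OF g v]]])
  qed
qed

text \<open>A non-terminal neighbour with the same owner would belong to the block, so outside it
  the owner has no say and \<open>ret\<close> leads back. The terminals met are exits, and infinite
  play is harmless as \<open>x\<close> is at most 0.\<close>

lemma guard_block:
  assumes u: "u \<in> Domain E"
    and start: "start \<in> block u \<or> (u, start) \<in> E"
    and ret: "\<And>v w. w \<in> block u \<Longrightarrow> (w, v) \<in> E \<Longrightarrow> v \<notin> T \<Longrightarrow> v \<notin> block u \<Longrightarrow> f v \<in> block u"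
    and x: "x \<le> 0" "\<And>t. t \<in> exits u \<Longrightarrow> x \<le> cost \<Gamma> (owner u) t"
  shows "guard (owner u) f x (block u \<union> E `` block u)"
  unfolding guard_def
proof (intro conjI disjI1 ballI)
  show "start \<in> block u \<union> E `` block u" using start block_self by blast
  show "moves (owner u) f `` (block u \<union> E `` block u) \<subseteq> block u \<union> E `` block u"
  proof
    fix y assume "y \<in> moves (owner u) f `` (block u \<union> E `` block u)"
    then obtain v where v: "v \<in> block u \<union> E `` block u" "(v, y) \<in> E" "owner v = owner u \<or> y = f v"
      by (auto simp: moves_def)
    show "y \<in> block u \<union> E `` block u"
    proof (cases "v \<in> block u")
      case False
      then obtain w where w: "w \<in> block u" "(w, v) \<in> E" using v(1) by blast
      have nT: "v \<notin> T" using v(2) tail_nonterminal by blast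
      then have "owner v \<noteq> owner u" using False block_arc w block_props(1)[OF w(1) u] by blast
      then show ?thesis using v(3) ret[OF w nT False] by blast
    qed (use v in blast)
  qed
  show "x \<le> cost \<Gamma> (owner u) t" if "t \<in> (block u \<union> E `` block u) \<inter> T" for t
    using that x(2) block_props(3)[OF _ u] by (auto simp: exits_def)
qed (rule x(1))

section \<open>Equilibria in the four cases\<close>

lemma nash_cheap_exit:
  assumes "t \<in> exits start" "cost \<Gamma> (owner start) t \<le> 0"
  shows "\<exists>\<sigma>. nash_equilibrium \<Gamma> \<sigma>"
proof -
  let ?B = "block start"
  obtain g and d :: "'v \<Rightarrow> nat" where g: "\<And>v. v \<in> Domain E \<Longrightarrow> (v, g v) \<in> E"
      "\<And>v. v \<in> Domain E \<Longrightarrow> exits v \<noteq> {} \<Longrightarrow> g v = best v \<or> g v \<in> block v \<and> d (g v) < d v"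
    using route by blast
  note B = block_props[OF _ start_nonterminal]
  define f where "f v = (if v \<in> ?B then g v else pick ?B v)" for v
  \<comment> \<open>The shift by one makes the final move, from distance 0 into the terminal, lower
    the rank too.\<close>
  define r where "r v = (if v \<in> T then 0 else Suc (d v))" for v
  have best_T: "best start \<in> T" using best_exits assms(1) by (auto simp: exits_def)
  show ?thesis
  proof (rule nash_finite[of f "?B \<union> {best start}" r "best start"])
    show "(v, f v) \<in> E" if "v \<in> Domain E" for v
      using that g(1) pick_arc by (simp add: f_def)
    show "f v \<in> ?B \<union> {best start} \<and> r (f v) < r v" if "v \<in> ?B \<union> {best start}" "v \<notin> T" for v
    proof -
      have v: "v \<in> ?B" using that best_T by auto
      have "exits v \<noteq> {}" using exits_block[OF v] assms(1) by auto
      then have "g v = best start \<or> g v \<in> ?B \<and> d (g v) < d v"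
        using g(2)[of v] B(2)[OF v] best_block[OF v start_nonterminal] block_eq[OF v] by auto
      then show ?thesis using v best_T B(3) that(2) by (auto simp: f_def r_def)
    qed
    show "\<exists>S. guard p f (cost \<Gamma> p (best start)) S" if "p \<in> owner ` (?B \<union> {best start} - T)" for p
    proof -
      have p: "p = owner start" using that best_T B(1) by auto
      have "guard (owner start) f (cost \<Gamma> (owner start) (best start)) (?B \<union> E `` ?B)"
      proof (rule guard_block[OF start_nonterminal])
        show "f v \<in> ?B" if "w \<in> ?B" "(w, v) \<in> E" "v \<notin> T" "v \<notin> ?B" for v w
          using that arc_sym[OF that(2,3)] pick_in by (auto simp: f_def)
        show "cost \<Gamma> (owner start) (best start) \<le> 0" using best_le[OF assms(1)] assms(2) by simp
      qed (auto intro: block_self best_le)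
      then show ?thesis using p by blast
    qed
  qed (use B(3) block_self in auto)
qed

text \<open>The link, possibly a loop, gives \<open>start\<close> a neighbour in its block; the
  other positions have one by \<open>block_neighbour\<close>. So \<open>pick\<close> never leaves
  the block.\<close>

lemma nash_start_cycle:
  assumes link: "(start, u) \<in> link"
    and exits: "\<And>t. t \<in> exits start \<Longrightarrow> 0 \<le> cost \<Gamma> (owner start) t"
  shows "\<exists>\<sigma>. nash_equilibrium \<Gamma> \<sigma>"
proof -
  let ?B = "block start"
  note B = block_props[OF _ start_nonterminal]
  show ?thesis
  proof (rule nash_infinite[of "pick ?B" ?B])
    show "pick ?B v \<in> ?B" if "v \<in> ?B" for v
    proof -
      have "\<exists>u\<in>?B. (v, u) \<in> E"
        using block_neighbour[OF that] link block_link[OF block_self link] by (auto simp: link_def)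
      then show ?thesis using pick_in by blast
    qed
    show "\<exists>S. guard p (pick ?B) 0 S" if "p \<in> owner ` ?B" for p
    proof -
      have p: "p = owner start" using that B(1) by auto
      have "guard (owner start) (pick ?B) 0 (?B \<union> E `` ?B)"
        by (rule guard_block[OF start_nonterminal])
          (use arc_sym pick_in exits block_self in blast)+
      then show ?thesis using p by blast
    qed
  qed (use B(3) block_self pick_arc in auto)
qed

lemma nash_neighbour_cycle:
  assumes isolated: "\<And>w. (start, w) \<notin> link"
    and start_exits: "\<And>t. t \<in> exits start \<Longrightarrow> 0 \<le> cost \<Gamma> (owner start) t"
    and u: "(start, u) \<in> E" "u \<notin> T"
    and exits: "\<And>t. t \<in> exits u \<Longrightarrow> 0 \<le> cost \<Gamma> (owner u) t"
  shows "\<exists>\<sigma>. nash_equilibrium \<Gamma> \<sigma>"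
proof -
  let ?U = "block u"
  let ?i = "owner start"
  have us: "(u, start) \<in> E" using arc_sym u .
  then have uD: "u \<in> Domain E" by blast
  note U = block_props[OF _ uD]
  have sT: "start \<notin> T" using u tail_nonterminal by blast
  have other: "owner w \<noteq> ?i" if "(start, w) \<in> E" "w \<notin> T" for w
    using isolated that by (auto simp: link_def)
  have sU: "start \<notin> ?U" using U(1) other[OF u] by auto
  \<comment> \<open>Entering \<open>U\<close> takes precedence over returning to
    \<open>start\<close>: the guard against the owner of \<open>U\<close> needs this, and the guard
    against \<open>?i\<close> contains \<open>U\<close> anyway.\<close>
  define f where "f v = (if v = start then u else if E `` {v} \<inter> ?U \<noteq> {} then pick ?U v
    else pick {start} v)" for v
  have f_start: "f start = u" by (simp add: f_def)
  have fU: "f v \<in> ?U" if "(v, w) \<in> E" "w \<in> ?U" for v w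
    using that pick_in block_self by (auto simp: f_def)
  have fU': "f v \<in> insert start ?U" if "v \<in> ?U" for v
  proof (cases "\<exists>w\<in>?U. (v, w) \<in> E")
    case False
    \<comment> \<open>Without a neighbour in \<open>U\<close>, the position must be
      \<open>u\<close>, and the play alternates between \<open>start\<close> and
      \<open>u\<close>.\<close>
    then have "v = u" using block_neighbour that by blast
    then have "f v = pick {start} u" using False sU that by (auto simp: f_def)
    then show ?thesis using pick_in[OF us, of "{start}"] by simp
  qed (use fU in blast)
  show ?thesis
  proof (rule nash_infinite[of f "insert start ?U"])
    show "(v, f v) \<in> E" if "v \<in> Domain E" for v
      using that pick_arc u by (simp add: f_def)
    show "f v \<in> insert start ?U" if "v \<in> insert start ?U" for v
      using that fU'[of v] block_self by (cases "v = start") (auto simp: f_start)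
    show "\<exists>S. guard p f 0 S" if "p \<in> owner ` insert start ?U" for p
    proof (cases "p = owner u")
      case True
      have "guard (owner u) f 0 (?U \<union> E `` ?U)"
        by (rule guard_block[OF uD]) (use us fU arc_sym exits in blast)+
      then show ?thesis using True by blast
    next
      case False
      then have p: "p = ?i" using that U(1) by auto
      \<comment> \<open>In this set \<open>?i\<close> decides only at \<open>start\<close>: its
        non-terminal neighbours have other owners and either return or enter \<open>U\<close>. The
        terminals in it are exits of \<open>start\<close>.\<close>
      let ?S = "insert start (E `` {start} \<union> ?U)"
      have "moves ?i f `` ?S \<subseteq> ?S"
      proof
        fix y assume "y \<in> moves ?i f `` ?S"
        then obtain v where v: "v \<in> ?S" "(v, y) \<in> E" "owner v = ?i \<or> y = f v"
          by (auto simp: moves_def)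
        have vT: "v \<notin> T" using v(2) tail_nonterminal by blast
        consider "v = start" | "v \<in> ?U" | "(start, v) \<in> E" "v \<notin> ?U" using v(1) by blast
        then show "y \<in> ?S"
        proof cases
          case 2
          then have "y = f v" using v(3) U(1) other[OF u] by auto
          then show ?thesis using fU'[OF 2] by blast
        next
          case 3
          have y: "y = f v" using v(3) other[OF 3(1) vT] by blast
          have vs: "(v, start) \<in> E" using arc_sym 3(1) vT .
          then have "pick {start} v = start" using pick_in[of v start "{start}"] by simp
          then have "y = start" if "E `` {v} \<inter> ?U = {}"
            using y that other[OF 3(1) vT] by (auto simp: f_def)
          moreover have "y \<in> ?U" if "E `` {v} \<inter> ?U \<noteq> {}" using that y fU by blast
          ultimately show ?thesis by blast
        qed (use v in blast)
      qed
      moreover have "0 \<le> cost \<Gamma> ?i t" if "t \<in> ?S \<inter> T" for t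
        using that start_exits U(3) sT block_self by (auto simp: exits_def)
      ultimately have "guard ?i f 0 ?S" by (auto simp: guard_def)
      then show ?thesis using p by blast
    qed
  qed (use sT U(3) in auto)
qed

text \<open>The outcome may cost the owner of \<open>start\<close> more than 0, so infinite play
  must be excluded as well. Hence the rank has to fall along every move that this player's
  deviations can produce.\<close>

lemma nash_neighbour_exit:
  assumes isolated: "\<And>w. (start, w) \<notin> link"
    and exits: "\<And>u. (start, u) \<in> E \<Longrightarrow> u \<notin> T \<Longrightarrow> \<exists>t\<in>exits u. cost \<Gamma> (owner u) t < 0"
  shows "\<exists>\<sigma>. nash_equilibrium \<Gamma> \<sigma>"
proof -
  let ?i = "owner start"
  obtain g and d :: "'v \<Rightarrow> nat" where g: "\<And>v. v \<in> Domain E \<Longrightarrow> (v, g v) \<in> E"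
      "\<And>v. v \<in> Domain E \<Longrightarrow> exits v \<noteq> {} \<Longrightarrow> g v = best v \<or> g v \<in> block v \<and> d (g v) < d v"
    using route by blast
  have sT: "start \<notin> T" using start_nonterminal tail_nonterminal by blast
  \<comment> \<open>the terminal that the play is meant to reach once \<open>i\<close> has moved to \<open>w\<close>\<close>
  define \<theta> where "\<theta> w = (if w \<in> T then w else best w)" for w
  define z where "z = arg_min_on (\<lambda>w. cost \<Gamma> ?i (\<theta> w)) (E `` {start})"
  have fin: "finite (E `` {start})"
    using finite_arcs by (auto intro: finite_subset[of _ "Range E"] finite_Range)
  have "E `` {start} \<noteq> {}" using start_nonterminal by blast
  then have z: "(start, z) \<in> E"
    using arg_min_if_finite(1)[OF fin] by (auto simp: z_def)
  have z_le: "cost \<Gamma> ?i (\<theta> z) \<le> cost \<Gamma> ?i (\<theta> w)" if "(start, w) \<in> E" for w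
    unfolding z_def using that arg_min_least[OF fin, of w "\<lambda>w. cost \<Gamma> ?i (\<theta> w)"] by blast
  \<comment> \<open>Empty if \<open>z\<close> is a terminal: then nobody is redirected, and only
    \<open>?i\<close> moves on the intended play.\<close>
  define U where "U = (if z \<in> T then {} else block z)"
  have D: "w \<in> Domain E" if "(start, w) \<in> E" "w \<notin> T" for w using arc_sym that by blast
  define W where "W = (\<Union>w\<in>E `` {start} - T. block w)"
  have other: "owner w \<noteq> ?i" if "(start, w) \<in> E" "w \<notin> T" for w
    using isolated that by (auto simp: link_def)
  \<comment> \<open>The witness \<open>w\<close> shows that the terminal aimed at from
    \<open>v\<close> is among those compared in the choice of \<open>z\<close>.\<close>
  have W: "\<exists>w. (start, w) \<in> E \<and> w \<notin> T \<and> v \<in> block w \<and> \<theta> w = best v \<and> best v \<in> T \<and> 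
      exits v \<noteq> {} \<and> v \<in> Domain E \<and> v \<notin> T \<and> owner v \<noteq> ?i \<and> v \<noteq> start \<and> block v \<subseteq> W" if "v \<in> W" for v
  proof -
    obtain w where w: "(start, w) \<in> E" "w \<notin> T" "v \<in> block w" using \<open>v \<in> W\<close> by (auto simp: W_def)
    have "exits v \<noteq> {}" using exits[OF w(1,2)] exits_block[OF w(3)] by auto
    moreover have "best v \<in> T" using best_exits[OF calculation] by (auto simp: exits_def)
    moreover have "owner v \<noteq> ?i" using other[OF w(1,2)] block_props(1)[OF w(3) D[OF w(1,2)]] by simp
    moreover have "block v \<subseteq> W" using w block_eq[OF w(3)] by (auto simp: W_def)
    moreover have "\<theta> w = best v" using best_block[OF w(3) D[OF w(1,2)]] w(2) by (simp add: \<theta>_def)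
    ultimately show ?thesis using w block_props(2,3)[OF w(3) D[OF w(1,2)]] by blast
  qed
  have U_W: "U \<subseteq> W" using z by (auto simp: U_def W_def)
  have U_block: "block v = U" "best v = \<theta> z" if "v \<in> U" for v
    using that block_eq best_block[of v z] D[OF z] by (auto simp: U_def \<theta>_def split: if_splits)
  have g_W: "g v = best v \<or> g v \<in> block v \<and> d (g v) < d v" if "v \<in> W" for v
    using g(2) W[OF that] by blast
  define f where "f v = (if v = start then z else if v \<in> U then g v
    else if E `` {v} \<inter> U \<noteq> {} then pick U v else g v)" for v
  have f_arc: "(v, f v) \<in> E" if "v \<in> Domain E" for v
    using that pick_arc z g(1) by (simp add: f_def)
  have "finite (d ` Domain E)" using finite_arcs by (simp add: finite_Domain)
  then obtain K where K: "\<And>v. v \<in> Domain E \<Longrightarrow> d v < K"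
    by (metis finite_nat_set_iff_bounded imageI)
  \<comment> \<open>A play from \<open>start\<close> may pass through other neighbouring blocks before it enters \<open>U\<close>, never after.\<close>
  define r where "r v = (if v \<in> T then 0 else if v = start then 2 * K + 2
    else if v \<in> U then Suc (d v) else K + 1 + d v)" for v
  have f_U: "f v = \<theta> z \<or> f v \<in> U \<and> r (f v) < r v" if "v \<in> U" for v
  proof -
    have vW: "v \<in> W" using that U_W by blast
    have "f v = g v" using W[OF vW] that by (auto simp: f_def)
    then have "f v = \<theta> z \<or> f v \<in> U \<and> d (f v) < d v" using g_W[OF vW] U_block[OF that] by simp
    moreover have "r y = Suc (d y)" if "y \<in> U" for y
      using W[of y] that U_W by (auto simp: r_def)
    ultimately show ?thesis using that by auto
  qed
  have f_W: "(f v \<in> W \<or> f v = best v) \<and> r (f v) < r v" if v: "v \<in> W" for v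
  proof -
    note Wv = W[OF v]
    have rv: "0 < r v" using Wv by (auto simp: r_def)
    have best: ?thesis if "f v = best v" using that rv Wv by (auto simp: r_def)
    consider "v \<in> U" | "v \<notin> U" "f v \<in> U" | "v \<notin> U" "f v \<notin> U" by blast
    then show ?thesis
    proof cases
      case 1
      then show ?thesis using f_U[OF 1] U_block[OF 1] U_W best by auto
    next
      case 2
      \<comment> \<open>The rank is at most \<open>K\<close> in \<open>U\<close> and at least
        \<open>K + 1\<close> in the other neighbouring blocks.\<close>
      have "r (f v) = Suc (d (f v))" "d (f v) < K"
        using W[of "f v"] 2 U_W K[of "f v"] by (auto simp: r_def)
      moreover have "r v \<ge> K + 1" using 2 Wv by (auto simp: r_def)
      ultimately show ?thesis using 2 U_W by auto
    next
      case 3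
      have "E `` {v} \<inter> U = {}"
      proof (rule ccontr)
        assume ne: "E `` {v} \<inter> U \<noteq> {}"
        then have "pick U v \<in> U" using pick_in by blast
        moreover have "v \<noteq> start" using Wv by blast
        then have "f v = pick U v" using ne 3(1) by (simp add: f_def)
        ultimately show False using 3 by simp
      qed
      moreover have "v \<noteq> start" using Wv by blast
      ultimately have "f v = g v" using 3(1) by (simp add: f_def)
      then consider "f v = best v" | "f v \<in> block v" "d (f v) < d v" using g_W[OF v] by auto
      then show ?thesis
      proof cases
        case 2
        have "f v \<in> W" using 2 Wv by blast
        then show ?thesis using 2 3 Wv W[of "f v"] by (auto simp: r_def)
      qed (rule best)
    qed
  qed
  have r_start: "r w < r start" if "(start, w) \<in> E" for w
  proof -
    have "w \<notin> T \<Longrightarrow> d w < K \<and> w \<noteq> start" using K D[OF that] other[OF that] by auto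
    then show ?thesis using sT by (auto simp: r_def)
  qed
  have \<theta>_T: "\<theta> z \<in> T" using W[of z] z block_self by (auto simp: \<theta>_def W_def)
  have start_U: "f start = z" by (simp add: f_def)
  have z_U: "z = \<theta> z \<or> z \<in> U" by (simp add: \<theta>_def U_def block_self)
  show ?thesis
  proof (rule nash_finite[of f "{start, \<theta> z} \<union> U" r "\<theta> z"])
    show "f v \<in> {start, \<theta> z} \<union> U \<and> r (f v) < r v" if "v \<in> {start, \<theta> z} \<union> U" "v \<notin> T" for v
    proof (cases "v = start")
      case True
      then show ?thesis using r_start[OF z] start_U z_U by auto
    next
      case False
      then have v: "v \<in> U" using that \<theta>_T by auto
      then show ?thesis using f_U[OF v] f_W U_W by auto
    qed
    show "({start, \<theta> z} \<union> U) \<inter> T \<subseteq> {\<theta> z}" using W U_W sT by blast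
    show "\<exists>S. guard p f (cost \<Gamma> p (\<theta> z)) S" if "p \<in> owner ` ({start, \<theta> z} \<union> U - T)" for p
    proof (cases "p = ?i")
      case True
      \<comment> \<open>Only the choice at \<open>start\<close> belongs to \<open>?i\<close> here.
        Each terminal in the set is a neighbour of \<open>start\<close> or equals
        \<open>\<theta> w\<close> for a neighbour \<open>w\<close>, so minimality of
        \<open>z\<close> applies.\<close>
      let ?S = "insert start (E `` {start} \<union> W \<union> best ` W)"
      have step: "y \<in> ?S \<and> r y < r v" if v: "v \<in> ?S" "(v, y) \<in> moves ?i f" for v y
      proof (cases "v = start")
        case True
        then show ?thesis using v(2) r_start by (auto simp: moves_def)
      next
        case False
        have "v \<notin> T" using v(2) tail_nonterminal by (auto simp: moves_def)
        then have vW: "v \<in> W" using v(1) False W block_self by (auto simp: W_def)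
        then have "y = f v" using v(2) W[OF vW] by (auto simp: moves_def)
        then show ?thesis using f_W[OF vW] vW by auto
      qed
      have "cost \<Gamma> ?i (\<theta> z) \<le> cost \<Gamma> ?i t" if t: "t \<in> ?S \<inter> T" for t
      proof -
        consider "(start, t) \<in> E" | v where "v \<in> W" "t = best v" using t sT W by blast
        then show ?thesis
        proof cases
          case 1
          then show ?thesis using z_le[of t] t by (auto simp: \<theta>_def)
        next
          case 2
          then show ?thesis using W[OF 2(1)] z_le by metis
        qed
      qed
      then have "guard ?i f (cost \<Gamma> ?i (\<theta> z)) ?S"
        unfolding guard_def using step by blast
      then show ?thesis using True by blast
    next
      case False
      then have "p \<in> owner ` U" using that \<theta>_T by auto
      then have zT: "z \<notin> T" and U: "U = block z" by (auto simp: U_def split: if_splits)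
      note zD = D[OF z zT]
      have p: "p = owner z" using \<open>p \<in> owner ` U\<close> U block_props(1)[OF _ zD] by auto
      \<comment> \<open>All non-terminal neighbours of the block, \<open>start\<close> included,
        move into it, and its best exit beats infinite play for its owner.\<close>
      have "guard (owner z) f (cost \<Gamma> (owner z) (best z)) (block z \<union> E `` block z)"
      proof (rule guard_block[OF zD])
        show "start \<in> block z \<or> (z, start) \<in> E" using arc_sym z zT by blast
        show "f v \<in> block z" if v: "w \<in> block z" "(w, v) \<in> E" "v \<notin> T" "v \<notin> block z" for v w
          using v arc_sym[OF v(2,3)] pick_in U block_self by (auto simp: f_def)
        obtain t where "t \<in> exits z" "cost \<Gamma> (owner z) t < 0" using exits[OF z zT] by blast
        then show "cost \<Gamma> (owner z) (best z) \<le> 0" using best_le[of t z] by simp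
      qed (rule best_le)
      then show ?thesis using p zT by (auto simp: \<theta>_def)
    qed
  qed (use f_arc in auto)
qed

lemma nash_exists: "\<exists>\<sigma>. nash_equilibrium \<Gamma> \<sigma>"
proof (cases "\<exists>t\<in>exits start. cost \<Gamma> (owner start) t \<le> 0")
  case True
  then show ?thesis using nash_cheap_exit by blast
next
  case False
  then have pos: "0 \<le> cost \<Gamma> (owner start) t" if "t \<in> exits start" for t using that by force
  show ?thesis
  proof (cases "\<exists>u. (start, u) \<in> link")
    case True
    then show ?thesis using nash_start_cycle pos by blast
  next
    case False
    \<comment> \<open>Either some non-terminal neighbour of \<open>start\<close> has no exit of
      negative cost for its owner, or all have one.\<close>
    then show ?thesis
      using nash_neighbour_cycle[OF _ pos] nash_neighbour_exit by (meson not_le)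
  qed
qed

end

theorem theorem2:
  fixes \<Gamma> :: "'v game_data"
  assumes "terminal_game \<Gamma>"
    and "edge_symmetric \<Gamma>"
  shows "\<exists>\<sigma>. nash_equilibrium \<Gamma> \<sigma>"
proof -
  interpret edge_symmetric_game \<Gamma> using assms by unfold_locales
  show ?thesis by (rule nash_exists)
qed

end
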